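(* The randomized online algorithm $\textsc{Random-Push}$ is dynamically optimal in expectation: there is a constant $c$ such that for every request sequence $\sigma$ (chosen by an oblivious adversary), $\mathbb{E}[\mathrm{cost}(\textsc{Random-Push}(\sigma))] \le c\cdot \mathrm{cost}(\textsc{Opt}(\sigma))$.
   Context: Self-adjusting complete tree model: a set $V$ of $n$ items is stored in a complete binary tree of $n$ servers, one item per server; the root has depth $0$ and an item's depth is that of its hosting server. Requests $\sigma=(\sigma^{(1)},\sigma^{(2)},\dots)$ to items are revealed online and originate at the root. Serving a request to an item at depth $d$ costs $d$ (access cost); a swap, exchanging the items of a server and its parent, costs $1$ (adjustment cost); the cost of an algorithm on $\sigma$ is the total of access and adjustment costs. $\textsc{Opt}$ denotes an optimal offline algorithm that knows $\sigma$ in advance. The adversary is oblivious: $\sigma$ is fixed independently of the algorithm's random bits. Algorithm $\textsc{Random-Push}$: upon a request to item $u$ hosted at server $s$ of depth $k$, it accesses $u$, moves $u$ to the root, and pushes the previous root item $v$ down along a random path starting at the root, where at each step one of the two children of the current server is chosen uniformly at random, for $k$ steps: each item on this path down to depth $k-1$ moves down one level to the next server on the path. The item $w$ that was hosted at the end of the path (at depth $k$) is then moved to the server $s$. The whole operation is implemented by swaps of cost $O(k)$. *)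

theory Defs
  imports
    "HOL-Probability.Probability"
    "HOL-Library.Sublist"
begin

text \<open>
  A server of the complete binary tree of height \<open>h\<close> is the sequence of left/right choices leading to
  it from the root \<open>[]\<close>; its depth is its length and its parent is \<open>butlast\<close> of it. All levels
  \<open>0, \<dots>, h\<close> are full, so there are \<open>2 ^ (h + 1) - 1\<close> servers and every walk of
  at most \<open>h\<close> steps from the root stays in the tree.
\<close>

type_synonym server = "bool list"

definition servers :: "nat \<Rightarrow> server set" where
  "servers h = {s. length s \<le> h}"

type_synonym 'a placement = "server \<Rightarrow> 'a"

text \<open>Values of a placement outside \<open>servers h\<close> are irrelevant.\<close>

definition is_placement :: "nat \<Rightarrow> 'a set \<Rightarrow> 'a placement \<Rightarrow> bool" where
  "is_placement h V \<pi> \<longleftrightarrow> bij_betw \<pi> (servers h) V"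

definition server_of :: "nat \<Rightarrow> 'a placement \<Rightarrow> 'a \<Rightarrow> server" where
  "server_of h \<pi> u = the_inv_into (servers h) \<pi> u"

definition depth :: "nat \<Rightarrow> 'a placement \<Rightarrow> 'a \<Rightarrow> nat" where
  "depth h \<pi> u = length (server_of h \<pi> u)"

text \<open>A swap is named by the lower of its two servers, which must not be the root.\<close>

definition swap_at :: "server \<Rightarrow> 'a placement \<Rightarrow> 'a placement" where
  "swap_at s \<pi> = \<pi>(s := \<pi> (butlast s), butlast s := \<pi> s)"

definition swappable :: "nat \<Rightarrow> server set" where
  "swappable h = servers h - {[]}"

definition apply_swaps :: "server list \<Rightarrow> 'a placement \<Rightarrow> 'a placement" where
  "apply_swaps ss \<pi> = fold swap_at ss \<pi>"

text \<open>
  An offline algorithm knowing the requests \<open>\<sigma>\<close> is a schedule: for each request, the list of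
  swaps performed after the previous request was served and before this one is. Swaps before the
  first request are allowed; swaps after the last one could only add cost. The minimum is over all
  schedules that start from the given initial placement.
\<close>

fun schedule_cost :: "nat \<Rightarrow> 'a placement \<Rightarrow> 'a list \<Rightarrow> server list list \<Rightarrow> nat" where
  "schedule_cost h \<pi> (u # \<sigma>) (ss # S) =
     length ss + depth h (apply_swaps ss \<pi>) u + schedule_cost h (apply_swaps ss \<pi>) \<sigma> S"
| "schedule_cost h \<pi> _ _ = 0"

definition schedules :: "nat \<Rightarrow> 'a list \<Rightarrow> server list list set" where
  "schedules h \<sigma> = {S. length S = length \<sigma> \<and> (\<forall>ss\<in>set S. set ss \<subseteq> swappable h)}"

definition opt_cost :: "nat \<Rightarrow> 'a placement \<Rightarrow> 'a list \<Rightarrow> nat" where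
  "opt_cost h \<pi> \<sigma> = (INF S\<in>schedules h \<sigma>. schedule_cost h \<pi> \<sigma> S)"

text \<open>
  Effect of a push along the walk ending in \<open>p\<close>, where the requested item is at \<open>s\<close> and
  \<open>length p = length s\<close>. The servers on the walk are the prefixes of \<open>p\<close>. If \<open>p = s\<close>, the item
  at the end of the walk is the requested one, so no item is left to be moved to \<open>s\<close>.
\<close>

definition push :: "'a placement \<Rightarrow> server \<Rightarrow> server \<Rightarrow> 'a placement" where
  "push \<pi> s p = (\<lambda>q.
     if q = [] then \<pi> s
     else if prefix q p then \<pi> (butlast q)
     else if q = s then \<pi> p
     else \<pi> q)"

text \<open>
  \<open>swaps_for \<pi> s p\<close> is a list of swaps that carries out \<open>push \<pi> s p\<close> at cost at most \<open>C\<close> times the depth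
  of \<open>s\<close>. The algorithm is specified only up to the choice of such an implementation.
\<close>

definition push_implementation ::
  "nat \<Rightarrow> 'a set \<Rightarrow> real \<Rightarrow> ('a placement \<Rightarrow> server \<Rightarrow> server \<Rightarrow> server list) \<Rightarrow> bool" where
  "push_implementation h V C swaps_for \<longleftrightarrow>
     (\<forall>\<pi> s p. is_placement h V \<pi> \<longrightarrow> s \<in> servers h \<longrightarrow> length p = length s \<longrightarrow>
        set (swaps_for \<pi> s p) \<subseteq> swappable h \<and>
        apply_swaps (swaps_for \<pi> s p) \<pi> = push \<pi> s p \<and>
        real (length (swaps_for \<pi> s p)) \<le> C * real (length s))"

text \<open>Distribution of the total (access and adjustment) cost.\<close>

fun random_push_cost ::
  "nat \<Rightarrow> ('a placement \<Rightarrow> server \<Rightarrow> server \<Rightarrow> server list) \<Rightarrow> 'a placement \<Rightarrow> 'a list \<Rightarrow> nat pmf" where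
  "random_push_cost h swaps_for \<pi> [] = return_pmf 0"
| "random_push_cost h swaps_for \<pi> (u # \<sigma>) =
     do {
       let s = server_of h \<pi> u;
       p \<leftarrow> replicate_pmf (length s) (pmf_of_set UNIV);
       let ss = swaps_for \<pi> s p;
       c \<leftarrow> random_push_cost h swaps_for (apply_swaps ss \<pi>) \<sigma>;
       return_pmf (depth h \<pi> u + length ss + c)
     }"

text \<open>
  Implementations exist with \<open>C = 3\<close>: move the item at \<open>p\<close> up to the root, which shifts the walk
  down by one; then, unless \<open>p = s\<close>, exchange the items at the root and at \<open>s\<close>.
\<close>

fun up_rev :: "server \<Rightarrow> server list" where
  "up_rev [] = []"
| "up_rev (b # r) = rev (b # r) # up_rev r"

definition up :: "server \<Rightarrow> server list" where
  "up s = up_rev (rev s)"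

definition standard_impl :: "'a placement \<Rightarrow> server \<Rightarrow> server \<Rightarrow> server list" where
  "standard_impl \<pi> s p = up p @ (if s = p then [] else up s @ tl (rev (up s)))"

lemma up_Nil [simp]: "up [] = []"
  and up_snoc [simp]: "up (s @ [b]) = (s @ [b]) # up s"
  by (simp_all add: up_def)

lemma length_up [simp]: "length (up s) = length s"
  by (induction s rule: rev_induct) auto

lemma set_up: "set (up s) \<subseteq> swappable (length s)"
  by (induction s rule: rev_induct) (auto simp: swappable_def servers_def)

lemma apply_swaps_append: "apply_swaps (xs @ ys) \<pi> = apply_swaps ys (apply_swaps xs \<pi>)"
  by (simp add: apply_swaps_def)

lemma apply_swaps_Cons: "apply_swaps (x # xs) \<pi> = apply_swaps xs (swap_at x \<pi>)"
  by (simp add: apply_swaps_def)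

lemma apply_swaps_Nil [simp]: "apply_swaps [] \<pi> = \<pi>"
  by (simp add: apply_swaps_def)

lemma apply_swaps_up:
  "apply_swaps (up p) \<pi> =
     (\<lambda>q. if q = [] then \<pi> p else if prefix q p then \<pi> (butlast q) else \<pi> q)"
proof (induction p arbitrary: \<pi> rule: rev_induct)
  case Nil
  show ?case by (simp add: fun_eq_iff)
next
  case (snoc b p)
  show ?case
  proof
    fix q
    have neq: "xs \<noteq> ys" if "length xs < length ys" for xs ys :: server
      using that by blast
    have *: "butlast q \<noteq> p" "butlast q \<noteq> p @ [b]" "q \<noteq> p @ [b]" if "prefix q p" "q \<noteq> []"
    proof -
      have "length q \<le> length p" "0 < length q"
        using prefix_length_le[OF that(1)] that(2) by simp_all
      then have "length (butlast q) < length p" "length (butlast q) < length (p @ [b])"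
          "length q < length (p @ [b])"
        unfolding length_butlast length_append list.size by linarith+
      then show "butlast q \<noteq> p" "butlast q \<noteq> p @ [b]" "q \<noteq> p @ [b]"
        by (blast dest: neq)+
    qed
    show "apply_swaps (up (p @ [b])) \<pi> q =
        (if q = [] then \<pi> (p @ [b])
         else if prefix q (p @ [b]) then \<pi> (butlast q) else \<pi> q)"
      using * up_snoc[of "[]" b]
      by (cases "q = []"; cases "prefix q p"; cases "q = p @ [b]"; cases "q = p")
        (simp_all add: apply_swaps_Cons snoc swap_at_def)
  qed
qed

lemma apply_swaps_up_down:
  assumes "s \<noteq> []"
  shows "apply_swaps (up s @ tl (rev (up s))) \<pi> = \<pi>([] := \<pi> s, s := \<pi> [])"
  using assms
proof (induction s arbitrary: \<pi> rule: rev_induct)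
  case Nil
  then show ?case by simp
next
  case (snoc b s)
  show ?case
  proof (cases "s = []")
    case True
    then show ?thesis
      using up_snoc[of "[]" b]
      by (simp add: apply_swaps_Cons swap_at_def fun_eq_iff)
  next
    case False
    then have "up s \<noteq> []"
      by (metis length_up length_0_conv)
    then have "apply_swaps (up (s @ [b]) @ tl (rev (up (s @ [b])))) \<pi> =
        swap_at (s @ [b]) (apply_swaps (up s @ tl (rev (up s))) (swap_at (s @ [b]) \<pi>))"
      by (simp add: apply_swaps_Cons apply_swaps_append)
    also have "\<dots> = \<pi>([] := \<pi> (s @ [b]), s @ [b] := \<pi> [])"
      using False by (auto simp: snoc.IH swap_at_def fun_eq_iff)
    finally show ?thesis .
  qed
qed

lemma push_implementation_standard_impl: "push_implementation h V 3 standard_impl"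
  unfolding push_implementation_def
proof (intro allI impI conjI)
  fix \<pi> :: "'a placement" and s p :: server
  assume s: "s \<in> servers h" and p: "length p = length s"
  have "swappable (length s) \<subseteq> swappable h"
    using s by (auto simp: swappable_def servers_def)
  moreover have "set (tl (rev (up s))) \<subseteq> set (up s)"
    using list.set_sel(2)[of "rev (up s)"] by (cases "up s = []") auto
  ultimately show "set (standard_impl \<pi> s p) \<subseteq> swappable h"
    using set_up[of s] set_up[of p] p by (auto simp: standard_impl_def)
  show "real (length (standard_impl \<pi> s p)) \<le> 3 * real (length s)"
  proof -
    have "length (standard_impl \<pi> s p) \<le> 3 * length s"
      using p by (cases "s = p") (simp_all add: standard_impl_def)
    then show ?thesis by linarith
  qed
  show "apply_swaps (standard_impl \<pi> s p) \<pi> = push \<pi> s p"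
  proof (cases "s = p")
    case True
    then show ?thesis
      unfolding standard_impl_def push_def by (auto simp: apply_swaps_up)
  next
    case False
    then have "s \<noteq> []" "\<not> prefix s p"
      using p by (auto simp: prefix_def)
    then have "apply_swaps (standard_impl \<pi> s p) \<pi> =
        (apply_swaps (up p) \<pi>)([] := apply_swaps (up p) \<pi> s, s := apply_swaps (up p) \<pi> [])"
      using False by (simp add: standard_impl_def apply_swaps_append[of "up p"] apply_swaps_up_down)
    also have "\<dots> = push \<pi> s p"
      unfolding apply_swaps_up push_def using \<open>s \<noteq> []\<close> \<open>\<not> prefix s p\<close>
      by (simp add: fun_eq_iff)
    finally show ?thesis .
  qed
qed

end

theory Submission
  imports Defs
begin

text \<open>
  The proof compares Random-Push with an arbitrary offline schedule through the potential
  \<open>\<Sum>v. d v - 2 * o v\<close> (truncated subtraction), where \<open>d v\<close> and \<open>o v\<close> are the depths of \<open>v\<close> in the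
  two trees. It starts at 0, and a swap of the schedule raises it by at most 2. If the
  requested item \<open>u\<close> has depth \<open>k\<close> in the tree of Random-Push, moving it to the root lowers the
  potential by at least \<open>k - 2 * o u\<close>. The push raises it in expectation by at most \<open>2 ^ (- j)\<close> for every
  item with \<open>2 * o v \<le> d v = j < k\<close>. As at most \<open>2 ^ (j div 2 + 1) - 2 \<le> 2 ^ j / 2\<close> items of level \<open>j\<close>
  other than the root item of the schedule have \<open>2 * o v \<le> j\<close>, the rise is at most \<open>k / 2\<close>, plus 1 if
  that root item is not \<open>u\<close>, that is, if \<open>o u > 0\<close>. So the expected drop is at least
  \<open>k / 2 - 3 * o u\<close>, which pays for the cost \<open>O(k)\<close> of the request up to \<open>O(o u)\<close>.
\<close>

section \<open>Servers, placements and swaps\<close>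

lemma finite_servers [simp]: "finite (servers h)"
  using finite_lists_length_le[of "UNIV :: bool set" h] by (simp add: servers_def)

lemma card_servers: "card (servers h) = 2 ^ Suc h - 1"
proof -
  have "card (servers h) = (\<Sum>i\<le>h. 2 ^ i)"
    using card_lists_length_le[of "UNIV :: bool set" h] by (simp add: servers_def)
  also have "\<dots> = 2 ^ Suc h - 1"
    by (induction h) auto
  finally show ?thesis .
qed

lemma finite_items: "is_placement h V \<pi> \<Longrightarrow> finite V"
  unfolding is_placement_def using bij_betw_finite finite_servers by blast

lemma server_of_eq:
  "\<lbrakk>is_placement h V \<pi>; s \<in> servers h\<rbrakk> \<Longrightarrow> server_of h \<pi> (\<pi> s) = s"
  unfolding is_placement_def server_of_def bij_betw_def by (simp add: the_inv_into_f_f)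

lemma
  assumes "is_placement h V \<pi>" "v \<in> V"
  shows server_of_in: "server_of h \<pi> v \<in> servers h"
    and placement_server_of [simp]: "\<pi> (server_of h \<pi> v) = v"
  using assms unfolding is_placement_def server_of_def bij_betw_def
  by (auto intro: the_inv_into_into f_the_inv_into_f)

lemma inj_on_server_of: "is_placement h V \<pi> \<Longrightarrow> inj_on (server_of h \<pi>) V"
  by (rule inj_on_inverseI[where g = \<pi>]) simp

lemma is_placement_swap_at:
  assumes "is_placement h V \<pi>" "s \<in> swappable h"
  shows "is_placement h V (swap_at s \<pi>)"
proof -
  have "s \<in> servers h" "butlast s \<in> servers h"
    using assms(2) by (auto simp: swappable_def servers_def)
  then have "bij_betw (Transposition.transpose s (butlast s)) (servers h) (servers h)"
    by simp
  \<comment> \<open>Exchanging two items amounts to permuting the servers first.\<close>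
  moreover have "swap_at s \<pi> = \<pi> \<circ> Transposition.transpose s (butlast s)"
    by (auto simp: swap_at_def fun_eq_iff Transposition.transpose_def)
  ultimately show ?thesis
    using assms(1) unfolding is_placement_def by (metis bij_betw_trans)
qed

lemma is_placement_apply_swaps:
  "\<lbrakk>is_placement h V \<pi>; set ss \<subseteq> swappable h\<rbrakk> \<Longrightarrow> is_placement h V (apply_swaps ss \<pi>)"
  by (induction ss arbitrary: \<pi>) (simp_all add: apply_swaps_Cons is_placement_swap_at)

text \<open>Only the item at the lower server \<open>s\<close> rises, and by one level. Falling
  depths are what matters, since the depth in the tree of the schedule enters the potential
  negatively.\<close>

lemma depth_swap_at:
  assumes "is_placement h V \<pi>" "s \<in> swappable h" "v \<in> V"
  shows "depth h \<pi> v \<le> depth h (swap_at s \<pi>) v + (if v = \<pi> s then 1 else 0)"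
proof -
  let ?q = "server_of h \<pi> v"
  note pl = is_placement_swap_at[OF assms(1,2)]
  have s: "s \<in> servers h" "butlast s \<in> servers h" "s \<noteq> []"
    using assms(2) by (auto simp: swappable_def servers_def)
  have q: "?q \<in> servers h" "\<pi> ?q = v"
    using assms by (simp_all add: server_of_in)
  consider "?q = s" | "?q \<noteq> s" "?q = butlast s" | "?q \<noteq> s" "?q \<noteq> butlast s" by blast
  then show ?thesis
  proof cases
    case 1
    then have "swap_at s \<pi> (butlast s) = v" using q s by (simp add: swap_at_def)
    then have "server_of h (swap_at s \<pi>) v = butlast s"
      using server_of_eq[OF pl] s by metis
    then show ?thesis using 1 q s by (auto simp: depth_def)
  next
    case 2
    then have "swap_at s \<pi> s = v" using q s by (simp add: swap_at_def)
    then have "server_of h (swap_at s \<pi>) v = s"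
      using server_of_eq[OF pl] s by metis
    then show ?thesis using 2 by (simp add: depth_def)
  next
    case 3
    then have "swap_at s \<pi> ?q = v" using q by (simp add: swap_at_def)
    then have "server_of h (swap_at s \<pi>) v = ?q"
      using server_of_eq[OF pl] q by metis
    then show ?thesis by (simp add: depth_def)
  qed
qed

section \<open>The potential under the swaps of the schedule\<close>

text \<open>\<open>\<pi>\<close> is the tree of Random-Push and \<open>\<rho>\<close> that of the
  schedule. Through the factor 2, only on the order of \<open>2 ^ (j div 2)\<close> items of level
  \<open>j\<close> can contribute to a rise.\<close>

definition potential :: "nat \<Rightarrow> 'a set \<Rightarrow> 'a placement \<Rightarrow> 'a placement \<Rightarrow> nat" where
  "potential h V \<pi> \<rho> = (\<Sum>v\<in>V. depth h \<pi> v - 2 * depth h \<rho> v)"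

lemma potential_refl [simp]: "potential h V \<pi> \<pi> = 0"
  by (simp add: potential_def)

lemma potential_swap_at:
  assumes "is_placement h V \<rho>" "s \<in> swappable h"
  shows "potential h V \<pi> (swap_at s \<rho>) \<le> potential h V \<pi> \<rho> + 2"
proof -
  have fin: "finite V" using assms(1) by (rule finite_items)
  have "potential h V \<pi> (swap_at s \<rho>)
      \<le> (\<Sum>v\<in>V. (depth h \<pi> v - 2 * depth h \<rho> v) + (if v = \<rho> s then 2 else 0))"
    unfolding potential_def
  proof (rule sum_mono)
    fix v assume "v \<in> V"
    from depth_swap_at[OF assms this]
    show "depth h \<pi> v - 2 * depth h (swap_at s \<rho>) v
        \<le> (depth h \<pi> v - 2 * depth h \<rho> v) + (if v = \<rho> s then 2 else 0)"
      by (auto split: if_splits)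
  qed
  also have "\<dots> \<le> potential h V \<pi> \<rho> + 2"
    using fin by (simp add: sum.distrib potential_def)
  finally show ?thesis .
qed

lemma potential_apply_swaps:
  "\<lbrakk>is_placement h V \<rho>; set ss \<subseteq> swappable h\<rbrakk> \<Longrightarrow>
    potential h V \<pi> (apply_swaps ss \<rho>) \<le> potential h V \<pi> \<rho> + 2 * length ss"
proof (induction ss arbitrary: \<rho>)
  case (Cons s ss)
  then have "potential h V \<pi> (apply_swaps ss (swap_at s \<rho>))
      \<le> potential h V \<pi> (swap_at s \<rho>) + 2 * length ss"
    by (simp add: is_placement_swap_at)
  with potential_swap_at[of h V \<rho> s \<pi>] Cons.prems show ?case
    by (simp add: apply_swaps_Cons)
qed simp

section \<open>Effect of one push\<close>

text \<open>An item strictly above the end of the walk sinks one level, the item at its end goes to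
  \<open>s\<close> on the same level, and the items off the walk stay. That the result is a
  placement is assumed here; it will follow from the implementation by swaps.\<close>

lemma
  assumes pl: "is_placement h V \<pi>" and pl': "is_placement h V (push \<pi> s p)"
    and s: "s \<in> servers h" and p: "length p = length s"
  shows depth_push_requested: "depth h (push \<pi> s p) (\<pi> s) = 0"
    and depth_push:
      "\<lbrakk>v \<in> V; v \<noteq> \<pi> s\<rbrakk> \<Longrightarrow> depth h (push \<pi> s p) v
        \<le> depth h \<pi> v + (if strict_prefix (server_of h \<pi> v) p then 1 else 0)"
proof -
  have *: "server_of h (push \<pi> s p) v = q" if "q \<in> servers h" "push \<pi> s p q = v" for v q
    using server_of_eq[OF pl' that(1)] that(2) by simp
  have "server_of h (push \<pi> s p) (\<pi> s) = []"
    by (rule *) (simp_all add: servers_def push_def)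
  then show "depth h (push \<pi> s p) (\<pi> s) = 0" by (simp add: depth_def)
  assume v: "v \<in> V" "v \<noteq> \<pi> s"
  let ?q = "server_of h \<pi> v"
  have q: "?q \<in> servers h" "\<pi> ?q = v" "?q \<noteq> s"
    using pl v by (auto simp: server_of_in)
  consider "strict_prefix ?q p" | "?q = p" | "\<not> prefix ?q p"
    by (auto simp: strict_prefix_def)
  then show "depth h (push \<pi> s p) v
        \<le> depth h \<pi> v + (if strict_prefix ?q p then 1 else 0)"
  proof cases
    case 1
    then obtain b r where "p = ?q @ b # r"
      by (auto elim: strict_prefixE')
    then have "prefix (?q @ [b]) p" "length (?q @ [b]) \<le> length p"
      by simp_all
    then have "server_of h (push \<pi> s p) v = ?q @ [b]"
      using q s p by (intro *) (auto simp: servers_def push_def)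
    then show ?thesis using 1 by (simp add: depth_def)
  next
    case 2
    \<comment> \<open>Since \<open>p\<close> and \<open>s\<close> are distinct and of equal length,
      \<open>s\<close> is off the walk and receives the item at \<open>p\<close>.\<close>
    then have "s \<noteq> []" "\<not> prefix s p"
      using p q(3) by (auto simp: prefix_def)
    then have "server_of h (push \<pi> s p) v = s"
      using q s 2 by (intro *) (auto simp: push_def)
    then show ?thesis using 2 p by (simp add: depth_def)
  next
    case 3
    then have "server_of h (push \<pi> s p) v = ?q"
      using q by (intro *) (auto simp: push_def)
    then show ?thesis by (simp add: depth_def)
  qed
qed

text \<open>The summand of the requested item drops to 0 from at least
  \<open>length s - 2 * depth h \<rho> (\<pi> s)\<close>. Both terms of this difference are written
  as additions, which keeps the inequality free of truncation.\<close>

lemma potential_push: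
  assumes pl: "is_placement h V \<pi>" and pl': "is_placement h V (push \<pi> s p)"
    and s: "s \<in> servers h" and p: "length p = length s"
  shows "potential h V (push \<pi> s p) \<rho> + length s \<le> potential h V \<pi> \<rho> + 2 * depth h \<rho> (\<pi> s)
    + (\<Sum>v | v \<in> V - {\<pi> s} \<and> 2 * depth h \<rho> v \<le> depth h \<pi> v.
        of_bool (strict_prefix (server_of h \<pi> v) p))"
proof -
  let ?u = "\<pi> s"
  have u: "?u \<in> V" using pl s by (auto simp: is_placement_def bij_betw_def)
  have fin: "finite V" using pl by (rule finite_items)
  let ?i = "\<lambda>v. of_bool (strict_prefix (server_of h \<pi> v) p) :: nat"
  let ?g = "\<lambda>\<pi> v. depth h \<pi> v - 2 * depth h \<rho> v"
  have "(\<Sum>v\<in>V-{?u}. ?g (push \<pi> s p) v)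
      \<le> (\<Sum>v\<in>V-{?u}. ?g \<pi> v + (if 2 * depth h \<rho> v \<le> depth h \<pi> v then ?i v else 0))"
  proof (rule sum_mono)
    fix v assume "v \<in> V - {?u}"
    then have "depth h (push \<pi> s p) v \<le> depth h \<pi> v + ?i v"
      using depth_push[OF assms, of v] by (auto split: if_splits)
    \<comment> \<open>If \<open>2 * depth h \<rho> v\<close> exceeds the old depth of
      \<open>v\<close>, it is at least the old depth plus 1, so the truncated difference is 0 even
      after sinking one level.\<close>
    then show "?g (push \<pi> s p) v
        \<le> ?g \<pi> v + (if 2 * depth h \<rho> v \<le> depth h \<pi> v then ?i v else 0)"
      by (auto simp: of_bool_def split: if_splits)
  qed
  also have "\<dots> = (\<Sum>v\<in>V-{?u}. ?g \<pi> v)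
      + (\<Sum>v | v \<in> V - {?u} \<and> 2 * depth h \<rho> v \<le> depth h \<pi> v. ?i v)"
    using fin by (simp only: sum.distrib sum.inter_filter finite_Diff)
  finally have A: "(\<Sum>v\<in>V-{?u}. ?g (push \<pi> s p) v) \<le> \<dots>" .
  have "potential h V \<xi> \<rho> = ?g \<xi> ?u + (\<Sum>v\<in>V-{?u}. ?g \<xi> v)" for \<xi>
    unfolding potential_def using fin u by (rule sum.remove)
  moreover have "depth h \<pi> ?u = length s"
    using server_of_eq[OF pl s] by (simp add: depth_def)
  ultimately show ?thesis
    using A depth_push_requested[OF assms] by simp
qed

section \<open>Distribution of the random walk\<close>

lemma pmf_replicate_pmf:
  fixes xs :: "'a list"
  shows "pmf (replicate_pmf (length xs) p) xs = (\<Prod>x\<leftarrow>xs. pmf p x)"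
proof (induction xs)
  case (Cons x xs)
  have "replicate_pmf (length (x # xs)) p
      = map_pmf (\<lambda>(y, ys). y # ys) (pair_pmf p (replicate_pmf (length xs) p))"
    by (simp add: pair_pmf_def map_pmf_def bind_assoc_pmf bind_return_pmf)
  \<comment> \<open>By injectivity a list has the mass of its head-tail pair, which is a product by
    independence.\<close>
  moreover have "inj (\<lambda>(y :: 'a, ys). y # ys)"
    by (auto simp: inj_on_def)
  ultimately show ?case
    using pmf_map_inj'[of "\<lambda>(y :: 'a, ys). y # ys" _ "(x, xs)"] Cons.IH by (simp add: pmf_pair)
qed simp

text \<open>The walk is uniform on the \<open>2 ^ k\<close> lists of length \<open>k\<close>, and
  \<open>2 ^ (k - length q)\<close> of them extend \<open>q\<close>.\<close>

lemma random_walk_prefix: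
  assumes "length q \<le> k"
  shows "measure_pmf.prob (replicate_pmf k (pmf_of_set (UNIV :: bool set))) {p. prefix q p}
    = 1 / 2 ^ length q"
proof -
  let ?W = "{p :: bool list. length p = k}"
  have fin: "finite ?W" and card: "card ?W = 2 ^ k"
    using finite_lists_length_eq[of "UNIV :: bool set" k] card_lists_length_eq[of "UNIV :: bool set" k]
    by simp_all
  have ne: "?W \<noteq> {}"
    using card by (metis card.empty power_not_zero zero_neq_numeral)
  have "replicate_pmf k (pmf_of_set (UNIV :: bool set)) = pmf_of_set ?W"
  proof (rule pmf_eqI)
    fix p
    show "pmf (replicate_pmf k (pmf_of_set (UNIV :: bool set))) p = pmf (pmf_of_set ?W) p"
    proof (cases "length p = k")
      case True
      then show ?thesis
        using pmf_replicate_pmf[of p "pmf_of_set UNIV"] fin ne card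
        by (simp add: prod_list_replicate map_replicate_const power_one_over)
    next
      case False
      then show ?thesis
        using fin ne by (simp add: pmf_eq_0_set_pmf set_replicate_pmf)
    qed
  qed
  moreover have "?W \<inter> {p. prefix q p} = (@) q ` {r. length r = k - length q}"
    using assms by (auto simp: prefix_def image_iff)
  then have "card (?W \<inter> {p. prefix q p}) = 2 ^ (k - length q)"
    using card_lists_length_eq[of "UNIV :: bool set" "k - length q"]
    by (simp add: card_image inj_on_def)
  then have "real (card (?W \<inter> {p. prefix q p})) = 2 ^ k / 2 ^ length q"
    using assms by (subst power_diff[symmetric]) auto
  ultimately show ?thesis
    using fin ne card by (simp add: measure_pmf_of_set)
qed

section \<open>Total weight of the items whose sinking can raise the potential\<close>

lemma two_power_half_le: "2 ^ Suc (j div 2) - 2 \<le> (2 ^ j / 2 :: real)"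
proof (cases "j \<le> 1")
  case True
  then have "j = 0 \<or> j = 1" by auto
  then show ?thesis by auto
next
  case False
  show ?thesis
  proof (cases "j = 2")
    case False
    \<comment> \<open>From \<open>j = 3\<close> on the exponents alone compare; at
      \<open>j = 2\<close> the two sides of the claim are equal.\<close>
    with \<open>\<not> j \<le> 1\<close> have "Suc (j div 2) \<le> j - 1" by auto
    then have "(2::real) ^ Suc (j div 2) \<le> 2 ^ (j - 1)" by (intro power_increasing) auto
    also have "\<dots> = 2 ^ j / 2" using \<open>\<not> j \<le> 1\<close> by (simp add: power_diff)
    finally show ?thesis by simp
  qed simp
qed

text \<open>The items summed sit in \<open>\<rho>\<close> at distinct non-root servers of depth at
  most \<open>j div 2\<close>, and each weighs \<open>1 / 2 ^ j\<close>. With the root item of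
  \<open>\<rho>\<close> included, the bound would fail at \<open>j = 0\<close>. The function
  \<open>d\<close> will be the depth in the tree of Random-Push.\<close>

lemma sum_level_le:
  assumes pl: "is_placement h V \<rho>"
  shows "(\<Sum>v | v \<in> V \<and> d v = j \<and> 2 * depth h \<rho> v \<le> d v \<and> depth h \<rho> v > 0. 1 / 2 ^ d v)
    \<le> (1 / 2 :: real)"
proof -
  let ?A = "{v \<in> V. d v = j \<and> 2 * depth h \<rho> v \<le> d v \<and> depth h \<rho> v > 0}"
  have "card ?A \<le> card (servers (j div 2) - {[]})"
  proof (rule card_inj_on_le)
    show "inj_on (server_of h \<rho>) ?A"
      using inj_on_server_of[OF pl] by (rule inj_on_subset) auto
    show "server_of h \<rho> ` ?A \<subseteq> servers (j div 2) - {[]}"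
      by (auto simp: servers_def depth_def)
  qed simp
  also have "\<dots> = 2 ^ Suc (j div 2) - 1 - 1"
    by (subst card_Diff_singleton) (simp_all add: card_servers, simp add: servers_def)
  finally have "card ?A \<le> 2 ^ Suc (j div 2) - 1 - 1" .
  \<comment> \<open>This rules out truncation before the count is carried over to the reals.\<close>
  moreover have "(2::nat) \<le> 2 ^ Suc (j div 2)" by simp
  ultimately have "card ?A + 2 \<le> 2 ^ Suc (j div 2)" by linarith
  then have "real (card ?A + 2) \<le> real (2 ^ Suc (j div 2))" by (rule of_nat_mono)
  then have "real (card ?A) + 2 \<le> 2 ^ Suc (j div 2)"
    by (simp only: of_nat_add of_nat_power of_nat_numeral)
  with two_power_half_le[of j] have "real (card ?A) \<le> 2 ^ j / 2" by linarith
  moreover have "(\<Sum>v\<in>?A. 1 / 2 ^ d v) = real (card ?A) / 2 ^ j"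
    by simp
  ultimately show ?thesis by (simp add: field_simps)
qed

text \<open>Each of the \<open>k\<close> levels contributes at most 1/2, apart from the root item of
  \<open>\<rho>\<close>. That item weighs at most 1 and is summed only if it differs from
  \<open>u\<close>; then \<open>u\<close> has depth at least 1 in \<open>\<rho>\<close>, which pays
  for it.\<close>

lemma sum_push_le:
  assumes pl: "is_placement h V \<rho>" and u: "u \<in> V"
  shows "(\<Sum>v | v \<in> V - {u} \<and> d v < k \<and> 2 * depth h \<rho> v \<le> d v. 1 / 2 ^ d v)
    \<le> real k / 2 + real (depth h \<rho> u)"
proof -
  have fin: "finite V" using pl by (rule finite_items)
  let ?A = "{v \<in> V. d v < k \<and> 2 * depth h \<rho> v \<le> d v \<and> depth h \<rho> v > 0}"
  let ?R = "{v \<in> V - {u}. depth h \<rho> v = 0}"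
  have "(\<Sum>v | v \<in> V - {u} \<and> d v < k \<and> 2 * depth h \<rho> v \<le> d v. 1 / 2 ^ d v)
      \<le> (\<Sum>v\<in>?A \<union> ?R. 1 / 2 ^ d v :: real)"
    using fin by (intro sum_mono2) auto
  also have "\<dots> = (\<Sum>v\<in>?A. 1 / 2 ^ d v) + (\<Sum>v\<in>?R. 1 / 2 ^ d v)"
    using fin by (intro sum.union_disjoint) auto
  also have "(\<Sum>v\<in>?A. 1 / 2 ^ d v :: real) = (\<Sum>j<k. \<Sum>v | v \<in> ?A \<and> d v = j. 1 / 2 ^ d v)"
    using fin by (intro sum.group[symmetric]) auto
  also have "\<dots> = (\<Sum>j<k. \<Sum>v | v \<in> V \<and> d v = j \<and> 2 * depth h \<rho> v \<le> d v \<and> depth h \<rho> v > 0.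
      1 / 2 ^ d v)"
    by (intro sum.cong) auto
  also have "\<dots> \<le> (\<Sum>j<k. 1 / 2)"
    by (intro sum_mono sum_level_le[OF pl])
  also have "(\<Sum>v\<in>?R. 1 / 2 ^ d v :: real) \<le> real (depth h \<rho> u)"
  proof -
    have root: "v = \<rho> []" if "v \<in> V" "depth h \<rho> v = 0" for v
      using placement_server_of[OF pl that(1)] that(2) by (simp add: depth_def)
    show ?thesis
    proof (cases "depth h \<rho> u = 0")
      case True
      then have "?R = {}" using root u by blast
      then show ?thesis by (simp only: sum.empty)
    next
      case False
      have "(\<Sum>v\<in>?R. 1 / 2 ^ d v :: real) \<le> (\<Sum>v\<in>{\<rho> []}. 1 / 2 ^ d v)"
        using root by (intro sum_mono2) auto
      also have "\<dots> \<le> 1" by simp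
      also have "\<dots> \<le> real (depth h \<rho> u)" using False by simp
      finally show ?thesis .
    qed
  qed
  finally show ?thesis by simp
qed

section \<open>Expectations for a single request\<close>

lemma set_random_walk:
  "set_pmf (replicate_pmf k (pmf_of_set (UNIV :: bool set))) = {p. length p = k}"
  by (simp add: set_replicate_pmf lists_UNIV)

lemma finite_random_walk: "finite {p :: bool list. length p = k}"
  using finite_lists_length_eq[of "UNIV :: bool set" k] by simp

text \<open>Finite support settles integrability of the cost and turns its expectation into a finite
  sum.\<close>

lemma finite_random_push_cost: "finite (set_pmf (random_push_cost h swaps_for \<pi> \<sigma>))"
  by (induction \<sigma> arbitrary: \<pi>) (auto simp: set_random_walk finite_random_walk Let_def)

text \<open>Total expectation, conditioning on the walk of the first request; given the walk, the
  cost is a constant plus the remaining cost.\<close>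

lemma expectation_random_push_cost_Cons:
  fixes h \<pi> u
  defines "s \<equiv> server_of h \<pi> u"
  shows "measure_pmf.expectation (random_push_cost h swaps_for \<pi> (u # \<sigma>)) real
    = measure_pmf.expectation (replicate_pmf (length s) (pmf_of_set UNIV)) (\<lambda>p.
        real (depth h \<pi> u) + real (length (swaps_for \<pi> s p))
        + measure_pmf.expectation
            (random_push_cost h swaps_for (apply_swaps (swaps_for \<pi> s p) \<pi>) \<sigma>) real)"
proof -
  let ?D = "replicate_pmf (length s) (pmf_of_set (UNIV :: bool set))"
  let ?E = "\<lambda>p. random_push_cost h swaps_for (apply_swaps (swaps_for \<pi> s p) \<pi>) \<sigma>"
  let ?f = "\<lambda>p. map_pmf (\<lambda>c. depth h \<pi> u + length (swaps_for \<pi> s p) + c) (?E p)"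
  have A: "random_push_cost h swaps_for \<pi> (u # \<sigma>) = bind_pmf ?D ?f"
    by (simp add: s_def Let_def map_pmf_def)
  have B: "measure_pmf.expectation (bind_pmf ?D ?f) real
      = (\<Sum>p | length p = length s. pmf ?D p *\<^sub>R measure_pmf.expectation (?f p) real)"
    by (rule pmf_expectation_bind)
      (simp_all add: finite_random_walk set_random_walk finite_random_push_cost)
  have C: "measure_pmf.expectation (?f p) real = real (depth h \<pi> u)
      + real (length (swaps_for \<pi> s p)) + measure_pmf.expectation (?E p) real" for p
    by (simp add: integrable_measure_pmf_finite[OF finite_random_push_cost])
  show ?thesis
    unfolding A B C
    by (rule integral_measure_pmf[OF finite_random_walk, symmetric]) (simp add: set_random_walk)
qed

text \<open>Half of the drop \<open>length s\<close> is used up by sinking items. Of the factor 3,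
  two units come from the summand of the requested item and one from the root item of
  \<open>\<rho>\<close>.\<close>

lemma expected_potential_push:
  assumes pl: "is_placement h V \<pi>" and pl\<rho>: "is_placement h V \<rho>" and s: "s \<in> servers h"
    and pl': "\<And>p. length p = length s \<Longrightarrow> is_placement h V (push \<pi> s p)"
  shows "measure_pmf.expectation (replicate_pmf (length s) (pmf_of_set UNIV))
      (\<lambda>p. real (potential h V (push \<pi> s p) \<rho>)) + real (length s) / 2
    \<le> real (potential h V \<pi> \<rho>) + 3 * real (depth h \<rho> (\<pi> s))"
proof -
  let ?u = "\<pi> s" and ?k = "length s"
  let ?D = "replicate_pmf ?k (pmf_of_set (UNIV :: bool set))"
  have u: "?u \<in> V" using pl s by (auto simp: is_placement_def bij_betw_def)
  have fin: "finite V" using pl by (rule finite_items)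
  let ?A = "{v \<in> V - {?u}. 2 * depth h \<rho> v \<le> depth h \<pi> v}"
  let ?i = "\<lambda>p v. of_bool (strict_prefix (server_of h \<pi> v) p) :: real"
  have int: "integrable ?D f" for f :: "bool list \<Rightarrow> real"
    by (rule integrable_measure_pmf_finite) (simp add: set_random_walk finite_random_walk)
  \<comment> \<open>An item sinks only if the walk passes through its server and goes on below it,
    so its level must be smaller than \<open>?k\<close>.\<close>
  have i: "measure_pmf.expectation ?D (\<lambda>p. ?i p v)
      \<le> (if depth h \<pi> v < ?k then 1 / 2 ^ depth h \<pi> v else 0)" for v
  proof -
    have "measure_pmf.expectation ?D (\<lambda>p. ?i p v)
        \<le> measure_pmf.expectation ?D
            (\<lambda>p. if depth h \<pi> v < ?k then indicator {p. prefix (server_of h \<pi> v) p} p else 0)"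
      by (rule integral_mono_AE[OF int int])
        (auto simp: AE_measure_pmf_iff set_random_walk strict_prefix_def depth_def
          dest: prefix_length_less[OF strict_prefixI])
    also have "\<dots> = (if depth h \<pi> v < ?k then 1 / 2 ^ depth h \<pi> v else 0)"
      by (simp add: random_walk_prefix depth_def)
    finally show ?thesis .
  qed
  have "measure_pmf.expectation ?D (\<lambda>p. real (potential h V (push \<pi> s p) \<rho>))
      \<le> measure_pmf.expectation ?D (\<lambda>p. real (potential h V \<pi> \<rho>) + 2 * real (depth h \<rho> ?u)
          - real ?k + (\<Sum>v\<in>?A. ?i p v))"
  proof (rule integral_mono_AE[OF int int])
    show "AE p in ?D. real (potential h V (push \<pi> s p) \<rho>)
        \<le> real (potential h V \<pi> \<rho>) + 2 * real (depth h \<rho> ?u) - real ?k + (\<Sum>v\<in>?A. ?i p v)"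
    proof (simp only: AE_measure_pmf_iff set_random_walk, intro ballI)
      fix p :: server assume "p \<in> {p. length p = ?k}"
      then have "real (potential h V (push \<pi> s p) \<rho> + ?k)
          \<le> real (potential h V \<pi> \<rho> + 2 * depth h \<rho> ?u
            + (\<Sum>v\<in>?A. of_bool (strict_prefix (server_of h \<pi> v) p)))"
        by (intro of_nat_mono potential_push[OF pl _ s] pl') auto
      then show "real (potential h V (push \<pi> s p) \<rho>)
          \<le> real (potential h V \<pi> \<rho>) + 2 * real (depth h \<rho> ?u) - real ?k + (\<Sum>v\<in>?A. ?i p v)"
        by (simp only: of_nat_add of_nat_sum of_nat_of_bool of_nat_mult of_nat_numeral)
    qed
  qed
  also have "\<dots> = real (potential h V \<pi> \<rho>) + 2 * real (depth h \<rho> ?u) - real ?k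
      + (\<Sum>v\<in>?A. measure_pmf.expectation ?D (\<lambda>p. ?i p v))"
    by (simp add: int)
  also have "(\<Sum>v\<in>?A. measure_pmf.expectation ?D (\<lambda>p. ?i p v))
      \<le> (\<Sum>v\<in>?A. if depth h \<pi> v < ?k then 1 / 2 ^ depth h \<pi> v else 0)"
    by (intro sum_mono i)
  also have "\<dots> = (\<Sum>v | v \<in> ?A \<and> depth h \<pi> v < ?k. 1 / 2 ^ depth h \<pi> v)"
    using fin by (intro sum.inter_filter[symmetric]) auto
  also have "\<dots> = (\<Sum>v | v \<in> V - {?u} \<and> depth h \<pi> v < ?k \<and> 2 * depth h \<rho> v \<le> depth h \<pi> v.
      1 / 2 ^ depth h \<pi> v)"
    by (intro sum.cong) auto
  also have "\<dots> \<le> real ?k / 2 + real (depth h \<rho> ?u)"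
    by (rule sum_push_le[OF pl\<rho> u])
  finally show ?thesis by simp
qed

section \<open>Amortised comparison with a schedule and with the optimum\<close>

text \<open>The induction needs two unrelated trees, as they diverge after one request. A request
  costs at most \<open>1 + C\<close> times its depth while the expected potential pays for half that
  depth, so the potential is weighted by \<open>2 * (1 + C)\<close>; the factor 3 per unit of
  offline depth then gives \<open>6 * (1 + C)\<close>.\<close>

lemma random_push_le_schedule:
  fixes C :: real
  assumes impl: "push_implementation h V C swaps_for" and C: "C \<ge> 0"
  shows "\<lbrakk>is_placement h V \<pi>; is_placement h V \<rho>; set \<sigma> \<subseteq> V; S \<in> schedules h \<sigma>\<rbrakk> \<Longrightarrow>
    measure_pmf.expectation (random_push_cost h swaps_for \<pi> \<sigma>) real
      \<le> 2 * (1 + C) * real (potential h V \<pi> \<rho>) + 6 * (1 + C) * real (schedule_cost h \<rho> \<sigma> S)"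
proof (induction \<sigma> arbitrary: \<pi> \<rho> S)
  case Nil
  then show ?case using C by simp
next
  case (Cons u \<sigma>)
  then obtain ss S' where S: "S = ss # S'" and ss: "set ss \<subseteq> swappable h"
    and S': "S' \<in> schedules h \<sigma>"
    by (cases S) (auto simp: schedules_def)
  note pl = Cons.prems(1)
  \<comment> \<open>The schedule swaps before it serves \<open>u\<close>, so its access cost is
    measured in \<open>\<rho>'\<close>.\<close>
  define \<rho>' where "\<rho>' = apply_swaps ss \<rho>"
  have pl\<rho>': "is_placement h V \<rho>'"
    unfolding \<rho>'_def using Cons.prems(2) ss by (rule is_placement_apply_swaps)
  define s where "s = server_of h \<pi> u"
  have s: "s \<in> servers h" "\<pi> s = u"
    unfolding s_def using Cons.prems by (auto simp: server_of_in)
  have k: "depth h \<pi> u = length s" by (simp add: depth_def s_def)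
  let ?D = "replicate_pmf (length s) (pmf_of_set (UNIV :: bool set))"
  have int: "integrable ?D f" for f :: "bool list \<Rightarrow> real"
    by (rule integrable_measure_pmf_finite) (simp add: set_random_walk finite_random_walk)
  have impl': "set (swaps_for \<pi> s p) \<subseteq> swappable h"
    "apply_swaps (swaps_for \<pi> s p) \<pi> = push \<pi> s p"
    "real (length (swaps_for \<pi> s p)) \<le> C * real (length s)" if "length p = length s" for p
    using impl pl s that unfolding push_implementation_def by blast+
  have pl': "is_placement h V (push \<pi> s p)" if "length p = length s" for p
    using is_placement_apply_swaps[OF pl impl'(1)[OF that]] impl'(2)[OF that] by simp
  let ?c = "6 * (1 + C) * real (schedule_cost h \<rho>' \<sigma> S')"
  have "measure_pmf.expectation (random_push_cost h swaps_for \<pi> (u # \<sigma>)) real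
      \<le> measure_pmf.expectation ?D (\<lambda>p. (1 + C) * real (length s) + ?c
          + 2 * (1 + C) * real (potential h V (push \<pi> s p) \<rho>'))"
    unfolding expectation_random_push_cost_Cons s_def[symmetric]
  proof (rule integral_mono_AE[OF int int], simp only: AE_measure_pmf_iff set_random_walk,
      intro ballI)
    fix p :: server assume "p \<in> {p. length p = length s}"
    then have p: "length p = length s" by simp
    \<comment> \<open>Obliviousness enters here: the same \<open>\<sigma>\<close> and
      \<open>S'\<close> serve for every outcome \<open>p\<close> of the walk.\<close>
    have "measure_pmf.expectation (random_push_cost h swaps_for (push \<pi> s p) \<sigma>) real
        \<le> 2 * (1 + C) * real (potential h V (push \<pi> s p) \<rho>') + ?c"
      using Cons.prems(3) by (intro Cons.IH pl' p pl\<rho>' S') auto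
    then show "real (depth h \<pi> u) + real (length (swaps_for \<pi> s p))
        + measure_pmf.expectation
            (random_push_cost h swaps_for (apply_swaps (swaps_for \<pi> s p) \<pi>) \<sigma>) real
        \<le> (1 + C) * real (length s) + ?c + 2 * (1 + C) * real (potential h V (push \<pi> s p) \<rho>')"
      using impl'(2,3)[OF p] k by (simp add: distrib_right)
  qed
  also have "\<dots> = 2 * (1 + C) * (measure_pmf.expectation ?D
      (\<lambda>p. real (potential h V (push \<pi> s p) \<rho>')) + real (length s) / 2) + ?c"
    by (simp add: int algebra_simps)
  also have "\<dots> \<le> 2 * (1 + C) * (real (potential h V \<pi> \<rho>') + 3 * real (depth h \<rho>' u)) + ?c"
    using expected_potential_push[OF pl pl\<rho>' s(1) pl'] s(2) C
    by (intro add_right_mono mult_left_mono) auto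
  also have "\<dots> \<le> 2 * (1 + C)
      * ((real (potential h V \<pi> \<rho>) + 3 * real (length ss)) + 3 * real (depth h \<rho>' u)) + ?c"
  proof (intro add_right_mono mult_left_mono)
    \<comment> \<open>The rise of 2 per swap is rounded up to 3, so that swaps and accesses of the
      schedule have the same coefficient.\<close>
    show "real (potential h V \<pi> \<rho>') \<le> real (potential h V \<pi> \<rho>) + 3 * real (length ss)"
      using potential_apply_swaps[OF Cons.prems(2) ss, of \<pi>] unfolding \<rho>'_def by linarith
  qed (use C in simp)
  also have "\<dots> = 2 * (1 + C) * real (potential h V \<pi> \<rho>)
      + 6 * (1 + C) * real (schedule_cost h \<rho> (u # \<sigma>) S)"
    by (simp add: S \<rho>'_def algebra_simps)
  finally show ?case .
qed

text \<open>An infimum of a nonempty set of naturals is a member of it; the schedule without swaps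
  shows nonemptiness.\<close>

lemma opt_cost_attained:
  obtains S where "S \<in> schedules h \<sigma>" "schedule_cost h \<pi> \<sigma> S = opt_cost h \<pi> \<sigma>"
proof -
  have "replicate (length \<sigma>) [] \<in> schedules h \<sigma>"
    by (simp add: schedules_def set_replicate_conv_if)
  then have "opt_cost h \<pi> \<sigma> \<in> schedule_cost h \<pi> \<sigma> ` schedules h \<sigma>"
    unfolding opt_cost_def by (intro Inf_nat_def1) blast
  then show thesis using that by auto
qed

theorem theorem3:
  shows "\<forall>C::real. \<exists>c::real. \<forall>(h::nat) (V::'a set) (\<pi>::'a placement)
           (swaps_for::'a placement \<Rightarrow> server \<Rightarrow> server \<Rightarrow> server list) (\<sigma>::'a list).
           is_placement h V \<pi> \<longrightarrow> push_implementation h V C swaps_for \<longrightarrow> set \<sigma> \<subseteq> V \<longrightarrow>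
           measure_pmf.expectation (random_push_cost h swaps_for \<pi> \<sigma>) real
             \<le> c * real (opt_cost h \<pi> \<sigma>)"
proof (intro allI exI impI)
  fix C :: real and h :: nat and V :: "'a set" and \<pi> :: "'a placement" and swaps_for \<sigma>
  assume pl: "is_placement h V \<pi>" and impl: "push_implementation h V C swaps_for"
    and \<sigma>: "set \<sigma> \<subseteq> V"
  \<comment> \<open>The amortised bound asks for a nonnegative constant, and enlarging
    \<open>C\<close> preserves the bound on the number of swaps.\<close>
  let ?C = "max C 0"
  have "push_implementation h V ?C swaps_for"
    unfolding push_implementation_def
  proof (intro allI impI conjI)
    fix \<xi> and s p :: server
    assume "is_placement h V \<xi>" "s \<in> servers h" "length p = length s"
    with impl have *: "set (swaps_for \<xi> s p) \<subseteq> swappable h"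
        "apply_swaps (swaps_for \<xi> s p) \<xi> = push \<xi> s p"
        "real (length (swaps_for \<xi> s p)) \<le> C * real (length s)"
      unfolding push_implementation_def by blast+
    show "set (swaps_for \<xi> s p) \<subseteq> swappable h" "apply_swaps (swaps_for \<xi> s p) \<xi> = push \<xi> s p"
      by (fact *)+
    have "C * real (length s) \<le> ?C * real (length s)" by (intro mult_right_mono) auto
    with *(3) show "real (length (swaps_for \<xi> s p)) \<le> ?C * real (length s)" by linarith
  qed
  moreover obtain S where "S \<in> schedules h \<sigma>" "schedule_cost h \<pi> \<sigma> S = opt_cost h \<pi> \<sigma>"
    by (rule opt_cost_attained)
  \<comment> \<open>Both sides start from \<open>\<pi>\<close>, so the initial potential is 0 and no
    additive term remains. The factor depends on \<open>C\<close> alone.\<close>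
  ultimately show "measure_pmf.expectation (random_push_cost h swaps_for \<pi> \<sigma>) real
      \<le> 6 * (1 + ?C) * real (opt_cost h \<pi> \<sigma>)"
    using random_push_le_schedule[of h V ?C swaps_for \<pi> \<pi> \<sigma> S] pl \<sigma> by simp
qed

end
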